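(* Let $H$ be a complex separable infinite-dimensional Hilbert space and let $B(H)$ be the algebra of all bounded linear operators on $H$. Then the set $\mathcal{CR}(H)=\{A\in B(H) : \text{the range of } A \text{ is closed in } H\}$ is WOT-Borel in $B(H)$.
   Context: A subset of $B(H)$ is called WOT-Borel if it belongs to the $\sigma$-algebra generated by the sets open in the weak operator topology on $B(H)$. *)

theory Defs
  imports "HOL-Analysis.Analysis"
begin

(* The inner product is linear in its first argument.  The real vector space structure and the
   norm come from real_normed_vector; the axioms scaleR_scaleC and norm_eq_sqrt_cinner tie them
   to the complex structure and to the inner product. *)
class complex_inner = real_normed_vector +
  fixes scaleC :: "complex \<Rightarrow> 'a \<Rightarrow> 'a" (infixr \<open>*\<^sub>C\<close> 75)
    and cinner :: "'a \<Rightarrow> 'a \<Rightarrow> complex"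
  assumes scaleC_add_right: "a *\<^sub>C (x + y) = a *\<^sub>C x + a *\<^sub>C y"
    and scaleC_add_left: "(a + b) *\<^sub>C x = a *\<^sub>C x + b *\<^sub>C x"
    and scaleC_scaleC: "a *\<^sub>C b *\<^sub>C x = (a * b) *\<^sub>C x"
    and scaleC_one: "1 *\<^sub>C x = x"
    and scaleR_scaleC: "r *\<^sub>R x = complex_of_real r *\<^sub>C x"
    and cinner_commute: "cinner x y = cnj (cinner y x)"
    and cinner_add_left: "cinner (x + y) z = cinner x z + cinner y z"
    and cinner_scaleC_left: "cinner (a *\<^sub>C x) y = a * cinner x y"
    and norm_eq_sqrt_cinner: "norm x = sqrt (Re (cinner x x))"

class chilbert_space = complex_inner + complete_space

global_interpretation complex_vector: vector_space "scaleC :: complex \<Rightarrow> 'a \<Rightarrow> 'a::complex_inner"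
  defines cspan = complex_vector.span
  by unfold_locales (simp_all add: scaleC_add_right scaleC_add_left scaleC_scaleC scaleC_one)

(* B(H): elements of the type of bounded linear maps are only real-linear, hence the
   homogeneity condition. *)
definition bounded_operators :: "('a::complex_inner \<Rightarrow>\<^sub>L 'a) set"
  where "bounded_operators = {A. \<forall>c x. blinfun_apply A (c *\<^sub>C x) = c *\<^sub>C blinfun_apply A x}"

(* The coarsest topology on B(H) that makes every functional A \<mapsto> \<langle>A x, y\<rangle> continuous; its
   underlying set is B(H), since U may be UNIV. *)
definition weak_operator_topology :: "('a::complex_inner \<Rightarrow>\<^sub>L 'a) topology"
  where "weak_operator_topology = topology_generated_by
    {{A \<in> bounded_operators. cinner (blinfun_apply A x) y \<in> U} | x y U. open U}"

definition WOT_Borel :: "('a::complex_inner \<Rightarrow>\<^sub>L 'a) set set"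
  where "WOT_Borel = sigma_sets bounded_operators {U. openin weak_operator_topology U}"

definition closed_range_operators :: "('a::complex_inner \<Rightarrow>\<^sub>L 'a) set"
  where "closed_range_operators = {A \<in> bounded_operators. closed (range (blinfun_apply A))}"

lemma topspace_weak_operator_topology:
  "topspace (weak_operator_topology :: ('a::complex_inner \<Rightarrow>\<^sub>L 'a) topology) = bounded_operators"
  unfolding weak_operator_topology_def topology_generated_by_topspace by blast

end

theory Submission
  imports Defs
begin

text \<open>The range of \<open>A\<close> is closed iff there is a constant \<open>N\<close> such that every vector \<open>A x\<close> is
  approximated arbitrarily well by vectors \<open>A z\<close> with \<open>\<parallel>z\<parallel> \<le> N \<parallel>A x\<parallel>\<close>. One direction is the
  Baire argument of the open mapping theorem applied in the range of \<open>A\<close>, the other the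
  geometric series argument. Up to an error term, \<open>x\<close> and \<open>z\<close> may be restricted to a countable
  dense set, so the condition is a countable combination of conditions on functions
  \<open>A \<mapsto> \<parallel>A x\<parallel>\<close>. These are WOT-Borel, because \<open>\<parallel>v\<parallel>\<^sup>2\<close> is the supremum of
  \<open>2 Re \<langle>v, y\<rangle> - \<parallel>y\<parallel>\<^sup>2\<close> over \<open>y\<close> in the dense set.\<close>

section \<open>Closed range as approximate solvability with a norm bound\<close>

instance chilbert_space \<subseteq> banach ..

lemma closed_range_imp_approximately_open:
  fixes f :: "'a::real_normed_vector \<Rightarrow> 'b::banach"
  assumes "bounded_linear f" and "closed (range f)"
  obtains C where "C \<ge> 0"
    "\<And>x e. e > 0 \<Longrightarrow> \<exists>z. norm z \<le> C * norm (f x) \<and> norm (f z - f x) < e"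
proof -
  interpret bounded_linear f by fact
  let ?X = "top_of_set (range f)"
  let ?F = "\<lambda>n::nat. closure (f ` cball 0 (real n))"
  have sub: "?F n \<subseteq> range f" for n
    by (rule closure_minimal) (use assms(2) in auto)
  have cm: "completely_metrizable_space ?X"
    using completely_metrizable_space_closedin[OF completely_metrizable_space_euclidean] assms(2)
    by simp
  have cover: "\<Union>(range ?F) = range f"
  proof -
    have "f x \<in> \<Union>(range ?F)" for x
    proof -
      obtain n :: nat where "norm x \<le> real n" using real_arch_simple by blast
      then have "f x \<in> ?F n" using closure_subset[of "f ` cball 0 (real n)"] by auto
      then show ?thesis by (rule UN_I[OF UNIV_I])
    qed
    moreover have "\<Union>(range ?F) \<subseteq> range f" by (rule UN_least) (rule sub)
    ultimately show ?thesis by (intro equalityI) auto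
  qed
  have "\<exists>n. ?X interior_of ?F n \<noteq> {}"
  proof (rule ccontr)
    assume "\<not> ?thesis"
    then have "?X interior_of \<Union>(range ?F) = {}"
      using cm by (intro Baire_category_alt) (auto intro!: closed_subset[OF sub])
    then show False
      unfolding cover by (metis UNIV_not_empty image_is_empty interior_of_topspace topspace_euclidean_subtopology)
  qed
  then obtain n y0 where "y0 \<in> ?X interior_of ?F n" by blast
  then obtain T where "openin ?X T" "y0 \<in> T" and T: "T \<subseteq> ?F n"
    by (auto simp: interior_of_def)
  then obtain r where r: "r > 0" "ball y0 r \<inter> range f \<subseteq> T" and y0: "y0 \<in> range f"
    unfolding openin_contains_ball by blast
  show ?thesis
  proof
    show "0 \<le> 4 * real n / r" using r by simp
    fix x and e :: real assume e: "e > 0"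
    show "\<exists>z. norm z \<le> 4 * real n / r * norm (f x) \<and> norm (f z - f x) < e"
    proof (cases "f x = 0")
      case True
      then show ?thesis using e by (intro exI[of _ 0]) (simp add: zero)
    next
      case False
      \<comment> \<open>This scales \<open>f x\<close> to norm \<open>r / 2\<close>, so
        \<open>y0\<close> and \<open>y0 + t *\<^sub>R f x\<close> both lie in the closed image of
        the ball of radius \<open>n\<close>. Subtracting near-preimages of the two and dividing by
        \<open>t\<close> costs norm at most \<open>2 * n / t\<close>, which is the constant above;
        two errors below \<open>t * e / 2\<close> become one below \<open>e\<close>.\<close>
      define t where "t = r / (2 * norm (f x))"
      have t: "t > 0" using r False by (simp add: t_def)
      have "y0 + t *\<^sub>R f x \<in> range f"
        using y0 by (metis add imageE rangeI scaleR)
      moreover have "y0 + t *\<^sub>R f x \<in> ball y0 r"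
        using r False by (simp add: t_def dist_norm)
      ultimately have "y0 + t *\<^sub>R f x \<in> ?F n" using r T by blast
      then obtain u where u: "norm u \<le> n" "norm (f u - (y0 + t *\<^sub>R f x)) < t * e / 2"
        using t e by (auto simp: closure_approachable dist_norm dest!: spec[of _ "t * e / 2"])
      have "y0 \<in> ?F n" using \<open>y0 \<in> T\<close> T by blast
      then obtain v where v: "norm v \<le> n" "norm (f v - y0) < t * e / 2"
        using t e by (auto simp: closure_approachable dist_norm dest!: spec[of _ "t * e / 2"])
      define z where "z = (1 / t) *\<^sub>R (u - v)"
      have "norm z = norm (u - v) / t" using t by (simp add: z_def)
      also have "\<dots> \<le> 2 * n / t"
        using t u(1) v(1) norm_triangle_ineq4[of u v] by (intro divide_right_mono) auto
      also have "\<dots> = 4 * real n / r * norm (f x)"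
        using r False by (simp add: t_def)
      finally have 1: "norm z \<le> 4 * real n / r * norm (f x)" .
      have "t *\<^sub>R (f z - f x) = (f u - (y0 + t *\<^sub>R f x)) - (f v - y0)"
        using t by (simp add: z_def scaleR diff algebra_simps)
      then have "t * norm (f z - f x) \<le> norm (f u - (y0 + t *\<^sub>R f x)) + norm (f v - y0)"
        using t norm_triangle_ineq4 by (metis abs_of_pos norm_scaleR)
      also have "\<dots> < t * e" using u v by simp
      finally have "norm (f z - f x) < e" using t by simp
      with 1 show ?thesis by blast
    qed
  qed
qed

text \<open>The slack \<open>e\<close> inside the norm bound is what later allows \<open>z\<close>
  to be taken from a dense set: if \<open>f x = 0\<close>, a bound without it would force
  \<open>z = 0\<close>.\<close>

lemma approximately_open_imp_closed_range:
  fixes f :: "'a::banach \<Rightarrow> 'b::real_normed_vector"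
  assumes "bounded_linear f" and dense: "closure D = UNIV" and "C \<ge> 0"
    and approx: "\<And>x e. \<lbrakk>x \<in> D; e > 0\<rbrakk> \<Longrightarrow>
      \<exists>z. norm z \<le> C * (norm (f x) + e) \<and> norm (f z - f x) < e"
  shows "closed (range f)"
proof -
  interpret bounded_linear f by fact
  have dense_image: "\<exists>x\<in>D. norm (f x - w) < e" if "w \<in> closure (range f)" "e > 0" for w e
  proof -
    have "continuous_on UNIV f" by (intro continuous_on continuous_intros)
    then have "range f \<subseteq> closure (f ` D)"
      using continuous_image_closure_subset[of UNIV f D] dense by simp
    then have "w \<in> closure (f ` D)"
      using that(1) closure_minimal[OF _ closed_closure] by blast
    then show ?thesis using that(2) by (auto simp: closure_approachable dist_norm)
  qed
  have "y \<in> range f" if y: "y \<in> closure (range f)" for y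
  proof -
    txt \<open>A preimage of \<open>y\<close> is the limit of approximate preimages whose steps decay geometrically.\<close>
    let ?P = "\<lambda>k s. norm (y - f s) < (1/2)^k"
    let ?Q = "\<lambda>k s s'. norm (s' - s) \<le> 2 * C * (1/2)^k"
    have base: "\<exists>s. ?P 0 s"
      using dense_image[OF y, of 1] by (auto simp: norm_minus_commute)
    have step: "\<exists>s'. ?P (Suc k) s' \<and> ?Q k s s'" if s: "?P k s" for k s
    proof -
      \<comment> \<open>Three errors below \<open>e\<close> must sum to less than
        \<open>(1/2)^Suc k\<close>, and \<open>norm (f x) + e\<close> stays below
        \<open>(1/2)^k + 3 * e\<close>, hence below \<open>2 * (1/2)^k\<close>.\<close>
      define e :: real where "e = (1/2)^k / 8"
      have e: "e > 0" by (simp add: e_def)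
      \<comment> \<open>The residual \<open>y - f s\<close> is not yet known to lie in the range. It
        is replaced by \<open>f (w - s)\<close>, and that by \<open>f x\<close> with
        \<open>x\<close> in \<open>D\<close>, where \<open>approx\<close> applies.\<close>
      obtain w where w: "norm (f w - y) < e"
        using dense_image[OF y e] by blast
      obtain x where x: "x \<in> D" "norm (f x - (f (w - s))) < e"
        using dense_image[OF _ e, of "f (w - s)"] closure_subset[of "range f"] by blast
      obtain z where z: "norm z \<le> C * (norm (f x) + e)" "norm (f z - f x) < e"
        using approx[OF x(1) e] by blast
      have "norm (f x) = norm ((f x - f (w - s)) + (f w - y) + (y - f s))" by (simp add: diff)
      also have "\<dots> \<le> norm (f x - f (w - s)) + norm (f w - y) + norm (y - f s)"
        by (intro norm_triangle_mono order_refl)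
      finally have "norm (f x) \<le> norm (f x - f (w - s)) + norm (f w - y) + norm (y - f s)" .
      then have "norm (f x) + e \<le> 2 * (1/2)^k"
        using x(2) w s e unfolding e_def by linarith
      then have "norm z \<le> C * (2 * (1/2)^k)"
        using z(1) \<open>C \<ge> 0\<close> by (meson mult_left_mono order_trans)
      then have "?Q k s (s + z)" by (simp add: mult_ac)
      moreover have "norm (y - f (s + z)) = norm ((f z - f x) + (f x - f (w - s)) + (f w - y))"
        by (subst norm_minus_commute) (simp add: diff add add.commute)
      then have "norm (y - f (s + z)) \<le> norm (f z - f x) + norm (f x - f (w - s)) + norm (f w - y)"
        by (simp only:) (intro norm_triangle_mono order_refl)
      then have "?P (Suc k) (s + z)"
        using x(2) w z(2) e unfolding e_def power_Suc by linarith
      ultimately show ?thesis by blast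
    qed
    obtain s where P: "\<And>k. ?P k (s k)" and Q: "\<And>k. ?Q k (s k) (s (Suc k))"
      using dependent_nat_choice[of ?P ?Q, OF base step] by blast
    have "summable (\<lambda>k. s (Suc k) - s k)"
      by (rule summable_comparison_test'[OF _ Q]) (intro summable_mult summable_geometric, simp)
    then have "convergent s"
      by (simp add: telescope_summable' summable_iff_convergent sum_lessThan_telescope
          convergent_diff_const_right_iff)
    then obtain l where "s \<longlonglongrightarrow> l" by (auto simp: convergent_def)
    then have "(\<lambda>k. y - f (s k)) \<longlonglongrightarrow> y - f l"
      by (intro tendsto_intros tendsto)
    moreover have "(\<lambda>k. y - f (s k)) \<longlonglongrightarrow> 0"
      by (rule Lim_null_comparison[OF _ LIMSEQ_power_zero[of "1/2::real"]])
         (auto intro!: always_eventually less_imp_le P)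
    ultimately have "y = f l" using LIMSEQ_unique by fastforce
    then show ?thesis by blast
  qed
  then show ?thesis by (simp add: closure_subset_eq[symmetric] subsetI)
qed

text \<open>All quantifiers now range over countable sets once \<open>D\<close> is countable.
  Writing \<open>f (z - x)\<close> makes each condition one on norms of \<open>f\<close> at fixed
  vectors.\<close>

lemma closed_range_iff_dense:
  fixes f :: "'a::banach \<Rightarrow> 'b::banach"
  assumes f: "bounded_linear f" and dense: "closure D = UNIV"
  shows "closed (range f) \<longleftrightarrow> (\<exists>N::nat. \<forall>x\<in>D. \<forall>m::nat. \<exists>z\<in>D.
    norm z \<le> real N * (norm (f x) + 1 / Suc m) \<and> norm (f (z - x)) < 1 / Suc m)"
    (is "_ \<longleftrightarrow> (\<exists>N. ?P N)")
proof
  interpret bounded_linear f by fact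
  assume "closed (range f)"
  then obtain C where C: "C \<ge> 0"
    "\<And>x e. e > 0 \<Longrightarrow> \<exists>z. norm z \<le> C * norm (f x) \<and> norm (f z - f x) < e"
    using closed_range_imp_approximately_open[OF f] by metis
  \<comment> \<open>The extra 1 pays for moving \<open>z\<close> to a point of \<open>D\<close> at
    distance less than \<open>e\<close>.\<close>
  obtain N :: nat where N: "C + 1 \<le> real N" using real_arch_simple by blast
  have "\<exists>z\<in>D. norm z \<le> N * (norm (f x) + 1 / Suc m) \<and> norm (f (z - x)) < 1 / Suc m" for x m
  proof -
    define e where "e = 1 / real (Suc m)"
    have e: "e > 0" by (simp add: e_def)
    obtain z where z: "norm z \<le> C * norm (f x)" "norm (f z - f x) < e"
      using C(2)[OF e] by blast
    have "isCont (\<lambda>d. norm (f d - f x)) z"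
      by (intro continuous_intros continuous)
    then have "((\<lambda>d. norm (f d - f x)) \<longlongrightarrow> norm (f z - f x)) (nhds z)"
      unfolding isCont_def by (rule tendsto_at_iff_tendsto_nhds[THEN iffD1])
    then have "\<forall>\<^sub>F d in nhds z. norm (f d - f x) < e"
      using z(2) by (rule order_tendstoD)
    then obtain \<delta> where \<delta>: "\<delta> > 0" "\<And>d. dist d z < \<delta> \<Longrightarrow> norm (f d - f x) < e"
      by (auto simp: eventually_nhds_metric)
    have "z \<in> closure D" using dense by simp
    then obtain d where "d \<in> D" "dist d z < min \<delta> e"
      using \<delta>(1) e unfolding closure_approachable by (metis min_less_iff_conj)
    then have d: "d \<in> D" "norm (f d - f x) < e" "dist z d < e"
      using \<delta>(2) by (auto simp: dist_commute)
    have "norm d \<le> norm z + dist z d"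
      unfolding dist_norm by norm
    also have "\<dots> \<le> (C + 1) * (norm (f x) + e)"
      using z(1) d(3) mult_nonneg_nonneg[OF C(1) less_imp_le[OF e]] norm_ge_zero[of "f x"]
      unfolding distrib_left distrib_right mult_1 by linarith
    also have "\<dots> \<le> N * (norm (f x) + e)"
      using N e by (intro mult_right_mono) auto
    finally show ?thesis using d by (auto simp: diff e_def)
  qed
  then show "\<exists>N. ?P N" by blast
next
  interpret bounded_linear f by fact
  assume "\<exists>N. ?P N"
  then obtain N where N: "?P N" by blast
  show "closed (range f)"
  proof (rule approximately_open_imp_closed_range[OF f dense, of "real N"])
    fix x and e :: real assume x: "x \<in> D" and e: "e > 0"
    obtain m where m: "1 / real (Suc m) < e"
      using nat_approx_posE[OF e] by blast
    obtain z where z: "norm z \<le> N * (norm (f x) + 1 / Suc m)" "norm (f (z - x)) < 1 / Suc m"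
      using N x by blast
    have "N * (norm (f x) + 1 / Suc m) \<le> N * (norm (f x) + e)"
      using m by (intro mult_left_mono) auto
    then show "\<exists>z. norm z \<le> N * (norm (f x) + e) \<and> norm (f z - f x) < e"
      using z m by (intro exI[of _ z]) (auto simp: diff)
  qed simp
qed

section \<open>The norm recovered from inner products with a dense set\<close>

lemma norm_diff_squared_cinner:
  fixes x y :: "'a::complex_inner"
  shows "(norm (x - y))\<^sup>2 = (norm x)\<^sup>2 - (2 * Re (cinner x y) - (norm y)\<^sup>2)"
proof -
  have sq: "(norm v)\<^sup>2 = Re (cinner v v)" for v :: 'a
  proof -
    \<comment> \<open>Since \<open>sqrt\<close> is negative at negative reals, this yields
      positivity of the inner product.\<close>
    have "0 \<le> sqrt (Re (cinner v v))"
      using norm_ge_zero[of v] by (simp add: norm_eq_sqrt_cinner)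
    then show ?thesis by (simp add: norm_eq_sqrt_cinner)
  qed
  have minus_left: "cinner (- v) w = - cinner v w" for v w :: 'a
    using cinner_scaleC_left[of "-1" v w] scaleR_scaleC[of "-1" v] by simp
  have comm: "Re (cinner v w) = Re (cinner w v)" for v w :: 'a
    by (subst cinner_commute) simp
  have diff_left: "cinner (u - v) w = cinner u w - cinner v w" for u v w :: 'a
    using cinner_add_left[of u "- v" w] minus_left[of v w] by simp
  have "Re (cinner (x - y) (x - y)) = Re (cinner x (x - y)) - Re (cinner y (x - y))"
    by (simp add: diff_left)
  also have "\<dots> = Re (cinner (x - y) x) - Re (cinner (x - y) y)"
    by (simp add: comm)
  also have "\<dots> = Re (cinner x x) - 2 * Re (cinner x y) + Re (cinner y y)"
    by (simp add: diff_left comm[of y x])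
  finally show ?thesis by (simp add: sq)
qed

text \<open>The two sides of the supremum formula differ by the square of
  \<open>norm (v - y)\<close>, which is nonnegative and arbitrarily small for \<open>y\<close> in
  \<open>D\<close>.\<close>

lemma norm_greater_iff_cinner_dense:
  fixes v :: "'a::complex_inner"
  assumes "closure D = UNIV"
  shows "c < (norm v)\<^sup>2 \<longleftrightarrow> (\<exists>y\<in>D. c < 2 * Re (cinner v y) - (norm y)\<^sup>2)"
proof
  assume "c < (norm v)\<^sup>2"
  moreover from this obtain y where "y \<in> D" "dist y v < sqrt ((norm v)\<^sup>2 - c)"
    using assms closure_approachable[of v D]
    by (metis UNIV_I diff_gt_0_iff_gt real_sqrt_gt_zero)
  ultimately have "(norm (v - y))\<^sup>2 < (norm v)\<^sup>2 - c"
    by (metis dist_commute dist_norm norm_ge_zero real_less_rsqrt real_sqrt_abs real_sqrt_less_iff abs_norm_cancel)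
  then show "\<exists>y\<in>D. c < 2 * Re (cinner v y) - (norm y)\<^sup>2"
    using \<open>y \<in> D\<close> by (intro bexI[of _ y]) (auto simp: norm_diff_squared_cinner)
next
  assume "\<exists>y\<in>D. c < 2 * Re (cinner v y) - (norm y)\<^sup>2"
  then show "c < (norm v)\<^sup>2"
    using norm_diff_squared_cinner[of v] by (smt (verit) zero_le_power2)
qed

section \<open>Measurability in the weak operator topology\<close>

text \<open>Presenting the sigma-algebra as a measure space makes the \<open>measurable\<close>
  method available; only its sets matter.\<close>

definition WOT_borel_algebra :: "('a::complex_inner \<Rightarrow>\<^sub>L 'a) measure"
  where "WOT_borel_algebra = sigma bounded_operators {U. openin weak_operator_topology U}"

lemma WOT_open_subset: "{U. openin weak_operator_topology U} \<subseteq> Pow bounded_operators"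
  using openin_subset topspace_weak_operator_topology by blast

lemma space_WOT_borel_algebra [simp]: "space WOT_borel_algebra = bounded_operators"
  unfolding WOT_borel_algebra_def by (rule space_measure_of[OF WOT_open_subset])

lemma sets_WOT_borel_algebra: "sets WOT_borel_algebra = WOT_Borel"
  unfolding WOT_borel_algebra_def WOT_Borel_def by (rule sets_measure_of[OF WOT_open_subset])

lemma measurable_cinner_WOT [measurable]:
  "(\<lambda>A. cinner (blinfun_apply A x) y) \<in> borel_measurable WOT_borel_algebra"
proof (rule borel_measurableI)
  fix U :: "complex set" assume "open U"
  then have "openin weak_operator_topology {A \<in> bounded_operators. cinner (blinfun_apply A x) y \<in> U}"
    unfolding weak_operator_topology_def by (intro topology_generated_by_Basis) blast
  moreover have "(\<lambda>A. cinner (blinfun_apply A x) y) -` U \<inter> space WOT_borel_algebra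
      = {A \<in> bounded_operators. cinner (blinfun_apply A x) y \<in> U}"
    by auto
  ultimately show "(\<lambda>A. cinner (blinfun_apply A x) y) -` U \<inter> space WOT_borel_algebra \<in> sets WOT_borel_algebra"
    unfolding sets_WOT_borel_algebra WOT_Borel_def by (auto intro: sigma_sets.Basic)
qed

lemma measurable_norm_WOT:
  fixes x :: "'a::complex_inner"
  assumes "countable D" and "closure D = (UNIV :: 'a set)"
  shows "(\<lambda>A. norm (blinfun_apply A x)) \<in> borel_measurable WOT_borel_algebra"
proof -
  have "(\<lambda>A. (norm (blinfun_apply A x))\<^sup>2) \<in> borel_measurable WOT_borel_algebra"
    \<comment> \<open>Each strict superlevel set becomes a countable union, over \<open>D\<close>,
      of sets given by the generating functionals.\<close>
    unfolding borel_measurable_iff_greater norm_greater_iff_cinner_dense[OF assms(2)]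
    using assms(1) by (intro allI) measurable
  then have "(\<lambda>A. sqrt ((norm (blinfun_apply A x))\<^sup>2)) \<in> borel_measurable WOT_borel_algebra"
    by measurable
  then show ?thesis by simp
qed

theorem theorem5p3:
  assumes separable: "separable_space (euclidean :: 'a::chilbert_space topology)"
    and infinite_dimensional: "\<nexists>B :: 'a set. finite B \<and> cspan B = UNIV"
  shows "(closed_range_operators :: ('a \<Rightarrow>\<^sub>L 'a) set) \<in> WOT_Borel"
proof -
  obtain D :: "'a set" where D: "countable D" "closure D = UNIV"
    using separable by (auto simp: separable_space_def)
  note measurable_norm_WOT[OF D, measurable]
  have "closed_range_operators = {A \<in> space WOT_borel_algebra. \<exists>N::nat. \<forall>x\<in>D. \<forall>m::nat. \<exists>z\<in>D.
      norm z \<le> real N * (norm (blinfun_apply A x) + 1 / Suc m)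
      \<and> norm (blinfun_apply A (z - x)) < 1 / Suc m}"
    unfolding closed_range_operators_def
    by (simp add: closed_range_iff_dense[OF blinfun.bounded_linear_right D(2)])
  \<comment> \<open>Countability of \<open>D\<close> and of the naturals turns the quantifiers into
    countable unions and intersections.\<close>
  also have "\<dots> \<in> sets WOT_borel_algebra"
    using D(1) by measurable
  finally show ?thesis by (simp add: sets_WOT_borel_algebra)
qed

end
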